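(* Let $\mathcal{M}$ and $\mathcal{N}$ be $n$-parameter rectangle persistence modules with underlying rectangles $R_\mathcal{M}=(a_1,b_1)\times\cdots\times(a_n,b_n)$ and $R_\mathcal{N}=(c_1,d_1)\times\cdots\times(c_n,d_n)$ respectively, where $a_i,c_i\in\mathbb{R}\cup\{-\infty\}$, $b_i,d_i\in\mathbb{R}\cup\{+\infty\}$, $a_i<b_i$, $c_i<d_i$ for $1\le i\le n$, and write $a=(a_1,\dots,a_n)$, $b=(b_1,\dots,b_n)$, $c=(c_1,\dots,c_n)$, $d=(d_1,\dots,d_n)$. Then $$d_I(\mathcal{M},\mathcal{N})=\min\Bigg\{\max\Big\{\min_{1\le i\le n}\frac{b_i-a_i}{2},\ \min_{1\le i\le n}\frac{d_i-c_i}{2}\Big\},\ \max\Big\{\|c-a\|_\infty,\ \|d-b\|_\infty\Big\}\Bigg\}.$$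
   Context: Fix a field $\mathbb{k}$ and $n\ge1$. On $\mathbb{R}^n$, $u\preceq v$ means $u_i\le v_i$ for all $i$. An $n$-parameter persistence module $\mathcal{M}$ is a functor from $(\mathbb{R}^n,\preceq)$ to $\mathbb{k}$-vector spaces: vector spaces $\mathcal{M}_u$ and linear transition maps $\varphi_\mathcal{M}(u,v):\mathcal{M}_u\to\mathcal{M}_v$ for $u\preceq v$, with $\varphi_\mathcal{M}(u,u)=\mathrm{id}$ and $\varphi_\mathcal{M}(v,w)\circ\varphi_\mathcal{M}(u,v)=\varphi_\mathcal{M}(u,w)$. A morphism is a natural transformation. The rectangle persistence module with underlying rectangle $R\subseteq\mathbb{R}^n$ ($R$ a product of $n$ one-parameter intervals) has $\mathcal{M}_u=\mathbb{k}$ for $u\in R$, $\mathcal{M}_u=0$ for $u\notin R$, and $\varphi_\mathcal{M}(u,v)=\mathrm{id}_\mathbb{k}$ for $u\preceq v$ both in $R$ (all other transition maps are zero). For $\epsilon\ge 0$ let $\vec\epsilon=(\epsilon,\dots,\epsilon)$, and let the $\epsilon$-shift $\mathcal{M}(\vec\epsilon)$ be given by $\mathcal{M}(\vec\epsilon)_u=\mathcal{M}_{u+\vec\epsilon}$ and $\varphi_{\mathcal{M}(\vec\epsilon)}(u,v)=\varphi_\mathcal{M}(u+\vec\epsilon,v+\vec\epsilon)$. $\mathcal{M}$ and $\mathcal{N}$ are $\epsilon$-interleaved if there are morphisms $f:\mathcal{M}\to\mathcal{N}(\vec\epsilon)$ and $g:\mathcal{N}\to\mathcal{M}(\vec\epsilon)$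 with $g_{u+\vec\epsilon}\circ f_u=\varphi_\mathcal{M}(u,u+2\vec\epsilon)$ and $f_{u+\vec\epsilon}\circ g_u=\varphi_\mathcal{N}(u,u+2\vec\epsilon)$ for all $u$. The interleaving distance is $d_I(\mathcal{M},\mathcal{N})=\inf\{\epsilon\in[0,+\infty):\mathcal{M},\mathcal{N}\text{ are }\epsilon\text{-interleaved}\}$, equal to $+\infty$ if there is no such $\epsilon$. $\|u\|_\infty=\max_i|u_i|$. Conventions in $\overline{\mathbb{R}}=\mathbb{R}\cup\{\pm\infty\}$: $x+(\pm\infty)=\pm\infty$ for $x\in\mathbb{R}$; $(+\infty)+(+\infty)=+\infty$ and $(-\infty)+(-\infty)=-\infty$ (so $(+\infty)-(-\infty)=+\infty$); $(+\infty)-(+\infty)=0$ and $(-\infty)-(-\infty)=0$; $|\pm\infty|=+\infty$; $-\infty<x<+\infty$ for $x\in\mathbb{R}$. *)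

theory Defs
  imports "HOL-Analysis.Analysis" "HOL-Algebra.Module"
begin

section \<open>Persistence modules\<close>

text \<open>
  Vector spaces over a field \<open>K\<close> are modules over \<open>K\<close> in the sense of \<^theory>\<open>HOL-Algebra.Module\<close>.
  The record type of modules extends that of rings; the ring multiplication and unit of such a
  module carry no meaning. Linear maps are considered only on carriers, so all equations between
  them are stated on carriers.
\<close>

definition linear_maps ::
    "('k, 'e) ring_scheme \<Rightarrow> ('k, 'v) module \<Rightarrow> ('k, 'w) module \<Rightarrow> ('v \<Rightarrow> 'w) set" where
  "linear_maps K V W =
    {h \<in> carrier V \<rightarrow> carrier W.
       (\<forall>x\<in>carrier V. \<forall>y\<in>carrier V. h (x \<oplus>\<^bsub>V\<^esub> y) = h x \<oplus>\<^bsub>W\<^esub> h y) \<and>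
       (\<forall>c\<in>carrier K. \<forall>x\<in>carrier V. h (c \<odot>\<^bsub>V\<^esub> x) = c \<odot>\<^bsub>W\<^esub> h x)}"

text \<open>
  Raw data of a persistence module. \<open>pm_map M u v\<close> is meaningful only for \<open>u \<le> v\<close>, where \<open>\<le>\<close> on
  \<^typ>\<open>real ^ 'n\<close> is the componentwise order.
\<close>

record ('k, 'v, 'n :: finite) pmodule =
  pm_space :: "real ^ 'n \<Rightarrow> ('k, 'v) module"
  pm_map :: "real ^ 'n \<Rightarrow> real ^ 'n \<Rightarrow> 'v \<Rightarrow> 'v"

locale persistence_module = Ring.field K
  for K :: "('k, 'e) ring_scheme" and M :: "('k, 'v, 'n :: finite) pmodule" +
  assumes space: "Module.module K (pm_space M u)"
    and map: "u \<le> v \<Longrightarrow> pm_map M u v \<in> linear_maps K (pm_space M u) (pm_space M v)"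
    and map_id: "x \<in> carrier (pm_space M u) \<Longrightarrow> pm_map M u u x = x"
    and map_comp: "u \<le> v \<Longrightarrow> v \<le> w \<Longrightarrow> x \<in> carrier (pm_space M u) \<Longrightarrow>
      pm_map M v w (pm_map M u v x) = pm_map M u w x"

definition pm_morphism :: "('k, 'e) ring_scheme \<Rightarrow> ('k, 'v, 'n :: finite) pmodule \<Rightarrow>
    ('k, 'w, 'n) pmodule \<Rightarrow> (real ^ 'n \<Rightarrow> 'v \<Rightarrow> 'w) \<Rightarrow> bool" where
  "pm_morphism K M N f \<longleftrightarrow>
    (\<forall>u. f u \<in> linear_maps K (pm_space M u) (pm_space N u)) \<and>
    (\<forall>u v. u \<le> v \<longrightarrow>
       (\<forall>x\<in>carrier (pm_space M u). pm_map N u v (f u x) = f v (pm_map M u v x)))"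

definition pm_shift :: "real \<Rightarrow> ('k, 'v, 'n :: finite) pmodule \<Rightarrow> ('k, 'v, 'n) pmodule" where
  "pm_shift \<epsilon> M =
    \<lparr>pm_space = (\<lambda>u. pm_space M (u + vec \<epsilon>)),
     pm_map = (\<lambda>u v. pm_map M (u + vec \<epsilon>) (v + vec \<epsilon>))\<rparr>"

definition interleaved :: "('k, 'e) ring_scheme \<Rightarrow> real \<Rightarrow> ('k, 'v, 'n :: finite) pmodule \<Rightarrow>
    ('k, 'w, 'n) pmodule \<Rightarrow> bool" where
  "interleaved K \<epsilon> M N \<longleftrightarrow>
    (\<exists>f g. pm_morphism K M (pm_shift \<epsilon> N) f \<and> pm_morphism K N (pm_shift \<epsilon> M) g \<and>
      (\<forall>u. \<forall>x\<in>carrier (pm_space M u).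
         g (u + vec \<epsilon>) (f u x) = pm_map M u (u + vec (2 * \<epsilon>)) x) \<and>
      (\<forall>u. \<forall>y\<in>carrier (pm_space N u).
         f (u + vec \<epsilon>) (g u y) = pm_map N u (u + vec (2 * \<epsilon>)) y))"

text \<open>The infimum is taken in \<^typ>\<open>ereal\<close>, so it is \<open>\<infinity>\<close> if the set is empty.\<close>

definition interleaving_distance :: "('k, 'e) ring_scheme \<Rightarrow> ('k, 'v, 'n :: finite) pmodule \<Rightarrow>
    ('k, 'w, 'n) pmodule \<Rightarrow> ereal" where
  "interleaving_distance K M N = Inf {ereal \<epsilon> |\<epsilon>. 0 \<le> \<epsilon> \<and> interleaved K \<epsilon> M N}"


section \<open>Rectangle modules\<close>

definition scalar_space :: "('k, 'e) ring_scheme \<Rightarrow> ('k, 'k) module" where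
  "scalar_space K =
    \<lparr>carrier = carrier K, mult = mult K, one = one K, zero = zero K, add = add K,
     smult = mult K\<rparr>"

definition null_space :: "('k, 'e) ring_scheme \<Rightarrow> ('k, 'k) module" where
  "null_space K = (scalar_space K)\<lparr>carrier := {\<zero>\<^bsub>K\<^esub>}\<rparr>"

definition rectangle_module ::
    "('k, 'e) ring_scheme \<Rightarrow> (real ^ 'n :: finite) set \<Rightarrow> ('k, 'k, 'n) pmodule" where
  "rectangle_module K R =
    \<lparr>pm_space = (\<lambda>u. if u \<in> R then scalar_space K else null_space K),
     pm_map = (\<lambda>u v x. if u \<in> R \<and> v \<in> R then x else \<zero>\<^bsub>K\<^esub>)\<rparr>"

definition open_rectangle :: "ereal ^ 'n \<Rightarrow> ereal ^ 'n \<Rightarrow> (real ^ 'n :: finite) set" where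
  "open_rectangle a b = {u. \<forall>i. a $ i < ereal (u $ i) \<and> ereal (u $ i) < b $ i}"

text \<open>
  The subsets of \<^typ>\<open>real ^ 'n\<close> satisfying \<^const>\<open>is_interval\<close> are exactly the products of
  one-parameter intervals.
\<close>

lemma is_interval_open_rectangle: "is_interval (open_rectangle a b)"
  unfolding is_interval_def open_rectangle_def Basis_vec_def
  apply (auto simp: inner_axis)
   apply (meson ereal_less_eq(3) less_le_trans order_trans)
  by (meson ereal_less_eq(3) le_less_trans order_trans)

lemma persistence_module_rectangle_module:
  fixes K (structure) and R :: "(real ^ 'n :: finite) set"
  assumes "Ring.field K" "is_interval R"
  shows "persistence_module K (rectangle_module K R)"
proof -
  interpret Ring.field K by fact
  have convex: "v \<in> R" if "u \<in> R" "w \<in> R" "u \<le> v" "v \<le> w" for u v w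
  proof -
    have "\<forall>i\<in>Basis. u \<bullet> i \<le> v \<bullet> i \<and> v \<bullet> i \<le> w \<bullet> i"
      using that(3,4) by (auto simp: Basis_vec_def inner_axis less_eq_vec_def)
    with assms(2) that(1,2) show ?thesis
      unfolding is_interval_def by metis
  qed
  have "Module.module K (scalar_space K)"
  proof (rule moduleI)
    show "abelian_group (scalar_space K)"
      by (rule abelian_groupI)
        (auto simp: scalar_space_def a_ac intro: bexI[of _ "\<ominus> _"] l_neg)
  qed (auto simp: scalar_space_def l_distr r_distr m_assoc is_cring)
  moreover have "Module.module K (null_space K)"
  proof (rule moduleI)
    show "abelian_group (null_space K)"
      by (rule abelian_groupI) (auto simp: null_space_def scalar_space_def)
  qed (auto simp: null_space_def scalar_space_def is_cring)
  ultimately have spaces: "Module.module K (pm_space (rectangle_module K R) u)" for u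
    by (simp add: rectangle_module_def)
  show ?thesis
  proof (intro persistence_module.intro persistence_module_axioms.intro)
    fix u v :: "real ^ 'n" assume "u \<le> v"
    show "pm_map (rectangle_module K R) u v
        \<in> linear_maps K (pm_space (rectangle_module K R) u) (pm_space (rectangle_module K R) v)"
      by (auto simp: rectangle_module_def linear_maps_def null_space_def scalar_space_def)
  next
    fix u v w :: "real ^ 'n" and x assume "u \<le> v" "v \<le> w"
    then show "pm_map (rectangle_module K R) v w (pm_map (rectangle_module K R) u v x) =
        pm_map (rectangle_module K R) u w x"
      using convex[of u w v] by (auto simp: rectangle_module_def)
  qed (use assms(1) spaces in \<open>auto simp: rectangle_module_def null_space_def split: if_splits\<close>)
qed


section \<open>Extended real conventions\<close>

text \<open>
  The library's subtraction on \<^typ>\<open>ereal\<close> has \<open>\<infinity> - \<infinity> = \<infinity>\<close> and \<open>-\<infinity> - -\<infinity> = \<infinity>\<close>, whereas both are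
  \<open>0\<close> under the convention used here. All other cases agree.
\<close>

definition ext_minus :: "ereal \<Rightarrow> ereal \<Rightarrow> ereal" (infixl \<open>-\<^sub>e\<close> 65) where
  "x -\<^sub>e y = (if \<bar>x\<bar> = \<infinity> \<and> x = y then 0 else x - y)"

definition linf_norm :: "ereal ^ 'n :: finite \<Rightarrow> ereal" where
  "linf_norm x = (MAX i. \<bar>x $ i\<bar>)"

end

(* An \<epsilon>-interleaving of two rectangle modules either composes to zero, which says that no
   interval [u, u + 2\<epsilon>] fits into either rectangle, or both of its morphisms are nonzero. In the
   second case, naturality spreads the nonvanishing at one point v of a morphism to the points
   below v in the source rectangle and to the points above v in the shifted target rectangle; moving
   one coordinate at a time, this yields the inequalities between the corners of the two rectangles.
   Conversely, zero morphisms and morphisms that are the identity wherever possible are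
   interleavings in the two cases. *)

theory Submission
  imports Defs
begin

section \<open>Comparisons of interval ends in the extended reals\<close>

lemma abs_ext_minus_le_iff:
  assumes "0 \<le> \<epsilon>"
  shows "\<bar>x -\<^sub>e y\<bar> \<le> ereal \<epsilon> \<longleftrightarrow> x \<le> y + ereal \<epsilon> \<and> y \<le> x + ereal \<epsilon>"
  \<comment> \<open>Equal infinities have difference 0 by convention, matching the two inequalities,
    which then hold trivially; if exactly one end is infinite, or they are opposite infinities, both
    sides fail.\<close>
  using assms by (cases x; cases y) (auto simp: ext_minus_def)

text \<open>Strictness excludes equal infinities, so an infinite side makes the left-hand side
  infinite and the right-hand inequality false.\<close>

lemma half_ext_minus_le_iff:
  assumes "x < y"
  shows "(y -\<^sub>e x) / 2 \<le> ereal \<epsilon> \<longleftrightarrow> y \<le> x + ereal (2 * \<epsilon>)"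
  using assms by (cases x; cases y) (auto simp: ext_minus_def field_simps)

lemma linf_norm_le_iff: "linf_norm x \<le> r \<longleftrightarrow> (\<forall>i. \<bar>x $ i\<bar> \<le> r)"
  unfolding linf_norm_def by (subst Max_le_iff) auto

lemma MIN_le_iff:
  fixes h :: "'i :: finite \<Rightarrow> 'b :: linorder"
  shows "(MIN i. h i) \<le> r \<longleftrightarrow> (\<exists>i. h i \<le> r)"
  by (subst Min_le_iff) auto

text \<open>Reals are dense in the extended reals, so inequalities between ends, finite or not, can
  be tested on real points. This form serves upper ends, the primed one lower ends.\<close>

lemma ereal_le_addI:
  fixes x y :: ereal
  assumes "\<And>t :: real. ereal t + ereal \<epsilon> < x \<Longrightarrow> ereal t < y"
  shows "x \<le> y + ereal \<epsilon>"
proof (rule ccontr)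
  assume "\<not> ?thesis"
  then obtain s where s: "y + ereal \<epsilon> < ereal s" "ereal s < x"
    using ereal_dense2[of "y + ereal \<epsilon>" x] by (auto simp: not_le)
  then have "ereal (s - \<epsilon>) < y" using assms[of "s - \<epsilon>"] by simp
  with s(1) show False by (cases y) auto
qed

lemma ereal_le_addI':
  fixes x y :: ereal
  assumes "\<And>t :: real. y < ereal t \<Longrightarrow> x < ereal t + ereal \<epsilon>"
  shows "x \<le> y + ereal \<epsilon>"
proof (rule ccontr)
  assume "\<not> ?thesis"
  then obtain s where s: "y + ereal \<epsilon> < ereal s" "ereal s < x"
    using ereal_dense2[of "y + ereal \<epsilon>" x] by (auto simp: not_le)
  then have "y < ereal (s - \<epsilon>)" by (cases y) auto
  from assms[OF this] s(2) show False by simp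
qed

section \<open>Where morphisms between rectangle modules can be nonzero\<close>

lemma rectangle_morphism_zero:
  assumes K: "Ring.field K"
    and f: "pm_morphism K (rectangle_module K R) (pm_shift \<epsilon> (rectangle_module K S)) f"
  shows "f u \<zero>\<^bsub>K\<^esub> = \<zero>\<^bsub>K\<^esub>"
proof -
  interpret Ring.field K by fact
  let ?V = "pm_space (rectangle_module K R) u"
  let ?W = "pm_space (pm_shift \<epsilon> (rectangle_module K S)) u"
  have lin: "f u \<in> linear_maps K ?V ?W"
    using f by (simp add: pm_morphism_def)
  have "\<zero>\<^bsub>K\<^esub> \<in> carrier ?V"
    by (simp add: rectangle_module_def scalar_space_def null_space_def)
  \<comment> \<open>Homogeneity for the scalar zero is enough: zero times anything is zero in both
    spaces.\<close>
  with lin have "f u (\<zero>\<^bsub>K\<^esub> \<odot>\<^bsub>?V\<^esub> \<zero>\<^bsub>K\<^esub>) = \<zero>\<^bsub>K\<^esub> \<odot>\<^bsub>?W\<^esub> f u \<zero>\<^bsub>K\<^esub>" "f u \<zero>\<^bsub>K\<^esub> \<in> carrier ?W"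
    by (auto simp: linear_maps_def)
  then show ?thesis
    by (auto simp: pm_shift_def rectangle_module_def null_space_def scalar_space_def
        split: if_splits)
qed

text \<open>Both spreading claims come from a naturality square in which one transition map is the
  identity. For \<open>u\<close> below \<open>v\<close> in \<open>R\<close>, the value
  \<open>f v x\<close> is the image of \<open>f u x\<close> under a target transition map, which
  therefore cannot be zero. For \<open>w\<close> above \<open>v\<close> outside \<open>R\<close>,
  the source map kills \<open>x\<close> while the target map would keep
  \<open>f v x\<close>.\<close>

lemma rectangle_morphism_support:
  assumes K: "Ring.field K"
    and f: "pm_morphism K (rectangle_module K R) (pm_shift \<epsilon> (rectangle_module K S)) f"
    and x: "x \<in> carrier K" and v: "v \<in> R" and nz: "f v x \<noteq> \<zero>\<^bsub>K\<^esub>"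
  shows "v + vec \<epsilon> \<in> S"
    and "u \<le> v \<Longrightarrow> u \<in> R \<Longrightarrow> u + vec \<epsilon> \<in> S"
    and "v \<le> w \<Longrightarrow> w + vec \<epsilon> \<in> S \<Longrightarrow> w \<in> R"
proof -
  interpret Ring.field K by fact
  let ?M = "rectangle_module K R"
  let ?N = "pm_shift \<epsilon> (rectangle_module K S)"
  have lin: "f u \<in> linear_maps K (pm_space ?M u) (pm_space ?N u)" for u
    using f by (simp add: pm_morphism_def)
  have nat: "pm_map ?N u w (f u y) = f w (pm_map ?M u w y)"
    if "u \<le> w" "y \<in> carrier (pm_space ?M u)" for u w y
    using f that by (simp add: pm_morphism_def)
  have space: "carrier (pm_space ?M u) = (if u \<in> R then carrier K else {\<zero>\<^bsub>K\<^esub>})" for u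
    by (simp add: rectangle_module_def scalar_space_def null_space_def)
  have "f v x \<in> carrier (pm_space ?N v)"
    using lin[of v] x v by (auto simp: linear_maps_def space)
  with nz show vS: "v + vec \<epsilon> \<in> S"
    by (auto simp: pm_shift_def rectangle_module_def null_space_def split: if_splits)
  show "u + vec \<epsilon> \<in> S" if "u \<le> v" "u \<in> R"
    using nat[of u v x] that x v nz
    by (auto simp: space) (auto simp: pm_shift_def rectangle_module_def split: if_splits)
  show "w \<in> R" if "v \<le> w" "w + vec \<epsilon> \<in> S"
  proof (rule ccontr)
    assume "w \<notin> R"
    with nat[of v w x] that(1) x v have "pm_map ?N v w (f v x) = f w \<zero>\<^bsub>K\<^esub>"
      by (simp add: space) (simp add: rectangle_module_def)
    with vS that(2) nz rectangle_morphism_zero[OF K f] show False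
      by (simp add: pm_shift_def rectangle_module_def)
  qed
qed

lemma rectangle_morphism_corners:
  fixes a b c d :: "ereal ^ 'n :: finite"
  assumes K: "Ring.field K"
    and f: "pm_morphism K (rectangle_module K (open_rectangle a b))
      (pm_shift \<epsilon> (rectangle_module K (open_rectangle c d))) f"
    and x: "x \<in> carrier K" and v: "v \<in> open_rectangle a b" and nz: "f v x \<noteq> \<zero>\<^bsub>K\<^esub>"
  shows "c $ i \<le> a $ i + ereal \<epsilon>" and "d $ i \<le> b $ i + ereal \<epsilon>"
proof -
  note supp = rectangle_morphism_support[OF assms]
  \<comment> \<open>Only coordinate \<open>i\<close> of \<open>v\<close> moves; the others keep
    satisfying the bounds known at \<open>v\<close>, so membership of \<open>upd t\<close> reduces
    to a condition on \<open>t\<close>.\<close>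
  define upd where "upd t = (\<chi> j. if j = i then t else v $ j)" for t
  have v': "a $ j < ereal (v $ j)" "ereal (v $ j) < b $ j"
    "c $ j < ereal (v $ j + \<epsilon>)" "ereal (v $ j + \<epsilon>) < d $ j" for j
    using v supp(1) by (auto simp: open_rectangle_def)
  show "c $ i \<le> a $ i + ereal \<epsilon>"
  proof (rule ereal_le_addI')
    fix t assume t: "a $ i < ereal t"
    show "c $ i < ereal t + ereal \<epsilon>"
    proof (cases "t \<le> v $ i")
      case True
      have "upd t \<in> open_rectangle a b"
        using t True v'
        by (auto simp: open_rectangle_def upd_def intro: le_less_trans[of _ "ereal (v $ i)"])
      moreover have "upd t \<le> v"
        using True by (auto simp: upd_def less_eq_vec_def)
      ultimately have "upd t + vec \<epsilon> \<in> open_rectangle c d" by (intro supp(2))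
      then have "c $ i < ereal ((upd t + vec \<epsilon>) $ i)" by (auto simp: open_rectangle_def)
      then show ?thesis by (simp add: upd_def)
    next
      \<comment> \<open>Here \<open>t\<close> lies above \<open>v $ i\<close>, and the bound at the
        shifted point \<open>v + vec \<epsilon>\<close> already suffices.\<close>
      case False
      then show ?thesis using v'(3)[of i] by (auto simp: not_le intro: less_trans[of _ "ereal (v $ i + \<epsilon>)"])
    qed
  qed
  show "d $ i \<le> b $ i + ereal \<epsilon>"
  proof (rule ereal_le_addI)
    fix t assume t: "ereal t + ereal \<epsilon> < d $ i"
    show "ereal t < b $ i"
    proof (cases "v $ i \<le> t")
      case True
      have "upd t + vec \<epsilon> \<in> open_rectangle c d"
        using t True v'
        by (auto simp: open_rectangle_def upd_def intro: less_le_trans[of _ "ereal (v $ i + \<epsilon>)"])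
      moreover have "v \<le> upd t"
        using True by (auto simp: upd_def less_eq_vec_def)
      ultimately have "upd t \<in> open_rectangle a b" by (intro supp(3))
      then have "ereal (upd t $ i) < b $ i" by (auto simp: open_rectangle_def)
      then show ?thesis by (simp add: upd_def)
    next
      case False
      then show ?thesis using v'(2)[of i] by (auto simp: not_le intro: less_trans[of _ "ereal (v $ i)"])
    qed
  qed
qed

section \<open>Interleavings of rectangle modules and the corner inequalities\<close>

definition rectangle_morphism ::
    "('k, 'e) ring_scheme \<Rightarrow> (real ^ 'n) set \<Rightarrow> (real ^ 'n :: finite) set \<Rightarrow> real \<Rightarrow> real ^ 'n \<Rightarrow> 'k \<Rightarrow> 'k"
  where "rectangle_morphism K R S \<epsilon> u x = (if u \<in> R \<and> u + vec \<epsilon> \<in> S then x else \<zero>\<^bsub>K\<^esub>)"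

text \<open>In the square from \<open>u\<close> to \<open>v\<close>, the path through the target
  returns \<open>x\<close> when \<open>u \<in> R\<close> and both shifted points lie in
  \<open>S\<close>; the path through the source does so when \<open>u\<close> and \<open>v\<close>
  lie in \<open>R\<close> and \<open>v + vec \<epsilon>\<close> in \<open>S\<close>.
  \<open>above\<close> passes from the first condition to the second, \<open>below\<close>
  back.\<close>

lemma pm_morphism_rectangle_morphism:
  fixes R S :: "(real ^ 'n :: finite) set"
  assumes K: "Ring.field K"
    and below: "\<And>u v. u \<in> R \<Longrightarrow> u \<le> v \<Longrightarrow> v \<in> R \<Longrightarrow> v + vec \<epsilon> \<in> S \<Longrightarrow> u + vec \<epsilon> \<in> S"
    and above: "\<And>u v. u \<in> R \<Longrightarrow> u \<le> v \<Longrightarrow> u + vec \<epsilon> \<in> S \<Longrightarrow> v + vec \<epsilon> \<in> S \<Longrightarrow> v \<in> R"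
  shows "pm_morphism K (rectangle_module K R) (pm_shift \<epsilon> (rectangle_module K S))
    (rectangle_morphism K R S \<epsilon>)"
proof -
  interpret Ring.field K by fact
  show ?thesis
    unfolding pm_morphism_def
  proof (intro conjI allI impI ballI)
    fix u :: "real ^ 'n"
    show "rectangle_morphism K R S \<epsilon> u \<in> linear_maps K (pm_space (rectangle_module K R) u)
        (pm_space (pm_shift \<epsilon> (rectangle_module K S)) u)"
      by (auto simp: linear_maps_def rectangle_morphism_def rectangle_module_def pm_shift_def
          null_space_def scalar_space_def)
  next
    fix u v :: "real ^ 'n" and x assume "u \<le> v"
    with below[of u v] above[of u v]
    show "pm_map (pm_shift \<epsilon> (rectangle_module K S)) u v (rectangle_morphism K R S \<epsilon> u x) =
        rectangle_morphism K R S \<epsilon> v (pm_map (rectangle_module K R) u v x)"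
      by (auto simp: rectangle_morphism_def rectangle_module_def pm_shift_def)
  qed
qed

lemma pm_morphism_zero:
  assumes K: "Ring.field K"
  shows "pm_morphism K (rectangle_module K R) (pm_shift \<epsilon> (rectangle_module K S)) (\<lambda>u x. \<zero>\<^bsub>K\<^esub>)"
proof -
  interpret Ring.field K by fact
  show ?thesis
    by (auto simp: pm_morphism_def linear_maps_def rectangle_module_def pm_shift_def
        null_space_def scalar_space_def)
qed

lemma interleaved_sym: "interleaved K \<epsilon> M N \<longleftrightarrow> interleaved K \<epsilon> N M"
  unfolding interleaved_def by blast

lemma interleaved_rectangle_zero:
  assumes K: "Ring.field K"
    and R: "\<And>u. u \<in> R \<Longrightarrow> u + vec (2 * \<epsilon>) \<notin> R"
    and S: "\<And>u. u \<in> S \<Longrightarrow> u + vec (2 * \<epsilon>) \<notin> S"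
  shows "interleaved K \<epsilon> (rectangle_module K R) (rectangle_module K S)"
  unfolding interleaved_def
proof (intro exI conjI)
  show "pm_morphism K (rectangle_module K R) (pm_shift \<epsilon> (rectangle_module K S)) (\<lambda>u x. \<zero>\<^bsub>K\<^esub>)"
    and "pm_morphism K (rectangle_module K S) (pm_shift \<epsilon> (rectangle_module K R)) (\<lambda>u x. \<zero>\<^bsub>K\<^esub>)"
    by (intro pm_morphism_zero K)+
qed (use R S in \<open>auto simp: rectangle_module_def\<close>)

lemma interleaved_rectangle_close:
  fixes a b c d :: "ereal ^ 'n :: finite"
  assumes K: "Ring.field K"
    and ac: "\<And>i. a $ i \<le> c $ i + ereal \<epsilon>" "\<And>i. c $ i \<le> a $ i + ereal \<epsilon>"
    and bd: "\<And>i. b $ i \<le> d $ i + ereal \<epsilon>" "\<And>i. d $ i \<le> b $ i + ereal \<epsilon>"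
  shows "interleaved K \<epsilon> (rectangle_module K (open_rectangle a b))
    (rectangle_module K (open_rectangle c d))"
proof -
  have up: "q < ereal (t + \<epsilon>)" if "p < ereal t" "q \<le> p + ereal \<epsilon>" for p q t
    using that by (cases p; cases q) auto
  have down: "ereal t < p" if "ereal (t + \<epsilon>) < q" "q \<le> p + ereal \<epsilon>" for p q t
    using that by (cases p; cases q) auto
  have morphism: "pm_morphism K (rectangle_module K (open_rectangle p q))
      (pm_shift \<epsilon> (rectangle_module K (open_rectangle r s)))
      (rectangle_morphism K (open_rectangle p q) (open_rectangle r s) \<epsilon>)"
    if pr: "\<And>i. r $ i \<le> p $ i + ereal \<epsilon>" and qs: "\<And>i. s $ i \<le> q $ i + ereal \<epsilon>"
    for p q r s :: "ereal ^ 'n"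
  proof (rule pm_morphism_rectangle_morphism[OF K])
    fix u v :: "real ^ 'n" assume uv: "u \<le> v"
    then have le: "ereal (u $ i) \<le> ereal (v $ i)" "ereal (u $ i + \<epsilon>) \<le> ereal (v $ i + \<epsilon>)" for i
      by (auto simp: less_eq_vec_def)
    show "u + vec \<epsilon> \<in> open_rectangle r s"
      if "u \<in> open_rectangle p q" "v + vec \<epsilon> \<in> open_rectangle r s"
      using that up[OF _ pr] unfolding open_rectangle_def
      by (auto intro: le_less_trans[OF le(2)])
    show "v \<in> open_rectangle p q"
      if "u \<in> open_rectangle p q" "v + vec \<epsilon> \<in> open_rectangle r s"
      using that down[OF _ qs] unfolding open_rectangle_def
      by (auto intro: less_le_trans[OF _ le(1)])
  qed
  have middle: "u + vec \<epsilon> \<in> open_rectangle r s"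
    if "\<And>i. r $ i \<le> p $ i + ereal \<epsilon>" "\<And>i. q $ i \<le> s $ i + ereal \<epsilon>"
      "u \<in> open_rectangle p q" "u + vec (2 * \<epsilon>) \<in> open_rectangle p q"
    for p q r s :: "ereal ^ 'n" and u :: "real ^ 'n"
    using that(3,4) up[OF _ that(1)] down[OF _ that(2), of "u $ i + \<epsilon>" i for i]
    by (auto simp: open_rectangle_def add.assoc)
  have shift2: "u + vec \<epsilon> + vec \<epsilon> = u + vec (2 * \<epsilon>)" for u :: "real ^ 'n"
    by (simp add: vec_eq_iff)
  show ?thesis
    unfolding interleaved_def
  proof (intro exI conjI allI ballI)
    show "pm_morphism K (rectangle_module K (open_rectangle a b))
        (pm_shift \<epsilon> (rectangle_module K (open_rectangle c d)))
        (rectangle_morphism K (open_rectangle a b) (open_rectangle c d) \<epsilon>)"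
      using ac bd by (intro morphism)
    show "pm_morphism K (rectangle_module K (open_rectangle c d))
        (pm_shift \<epsilon> (rectangle_module K (open_rectangle a b)))
        (rectangle_morphism K (open_rectangle c d) (open_rectangle a b) \<epsilon>)"
      using ac bd by (intro morphism)
  qed (use middle[OF ac(2) bd(1)] middle[OF ac(1) bd(2)] in
      \<open>auto simp: rectangle_morphism_def rectangle_module_def shift2\<close>)
qed

text \<open>If every side is longer than \<open>2 * \<epsilon>\<close>, some \<open>u\<close> stays
  in the rectangle after a shift by \<open>2 * \<epsilon>\<close>. There the composite is the
  identity, so neither factor vanishes, and each factor contributes two of the four
  inequalities.\<close>

lemma interleaved_rectangle_imp_close:
  fixes a b c d :: "ereal ^ 'n :: finite"
  assumes K: "Ring.field K" and \<epsilon>: "0 \<le> \<epsilon>"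
    and int: "interleaved K \<epsilon> (rectangle_module K (open_rectangle a b))
      (rectangle_module K (open_rectangle c d))"
    and wide: "\<And>i. a $ i + ereal (2 * \<epsilon>) < b $ i"
  shows "a $ i \<le> c $ i + ereal \<epsilon>" "c $ i \<le> a $ i + ereal \<epsilon>"
    "b $ i \<le> d $ i + ereal \<epsilon>" "d $ i \<le> b $ i + ereal \<epsilon>"
proof -
  interpret Ring.field K by fact
  let ?R = "open_rectangle a b"
  let ?S = "open_rectangle c d"
  obtain f g where f: "pm_morphism K (rectangle_module K ?R) (pm_shift \<epsilon> (rectangle_module K ?S)) f"
    and g: "pm_morphism K (rectangle_module K ?S) (pm_shift \<epsilon> (rectangle_module K ?R)) g"
    and gf: "\<And>u x. x \<in> carrier (pm_space (rectangle_module K ?R) u) \<Longrightarrow>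
      g (u + vec \<epsilon>) (f u x) = pm_map (rectangle_module K ?R) u (u + vec (2 * \<epsilon>)) x"
    using int unfolding interleaved_def by blast
  have "\<exists>s. a $ i + ereal (2 * \<epsilon>) < ereal s \<and> ereal s < b $ i" for i
    using ereal_dense2[OF wide] by blast
  then obtain s where s: "\<And>i. a $ i + ereal (2 * \<epsilon>) < ereal (s i)" "\<And>i. ereal (s i) < b $ i"
    by metis
  \<comment> \<open>\<open>s\<close> gives the coordinates of the far endpoint
    \<open>u + vec (2 * \<epsilon>)\<close>, chosen with room to step back by
    \<open>2 * \<epsilon>\<close>.\<close>
  define u where "u = (\<chi> i. s i - 2 * \<epsilon>)"
  have pos: "a $ i < ereal (s i - 2 * \<epsilon>)" for i
    using s(1)[of i] by (cases "a $ i") auto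
  have u: "u \<in> ?R"
    using pos s(2) \<epsilon> unfolding open_rectangle_def u_def
    by (auto intro: le_less_trans[OF _ s(2)])
  have u2: "u + vec (2 * \<epsilon>) \<in> ?R"
    using pos s(2) \<epsilon> unfolding open_rectangle_def u_def
    by (auto intro: less_le_trans[OF pos])
  have gf1: "g (u + vec \<epsilon>) (f u \<one>\<^bsub>K\<^esub>) = \<one>\<^bsub>K\<^esub>"
    using gf[of "\<one>\<^bsub>K\<^esub>" u] u u2 by (simp add: rectangle_module_def scalar_space_def)
  have f_nz: "f u \<one>\<^bsub>K\<^esub> \<noteq> \<zero>\<^bsub>K\<^esub>"
    using gf1 rectangle_morphism_zero[OF K g] by auto
  have f_in: "f u \<one>\<^bsub>K\<^esub> \<in> carrier K"
  proof -
    have "f u \<in> linear_maps K (pm_space (rectangle_module K ?R) u)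
        (pm_space (pm_shift \<epsilon> (rectangle_module K ?S)) u)"
      using f by (simp add: pm_morphism_def)
    with u show ?thesis
      by (auto simp: linear_maps_def rectangle_module_def pm_shift_def scalar_space_def
          null_space_def Pi_iff split: if_splits)
  qed
  have uS: "u + vec \<epsilon> \<in> ?S"
    by (rule rectangle_morphism_support(1)[OF K f one_closed u f_nz])
  show "c $ i \<le> a $ i + ereal \<epsilon>" "d $ i \<le> b $ i + ereal \<epsilon>"
    by (rule rectangle_morphism_corners[OF K f one_closed u f_nz])+
  have g_nz: "g (u + vec \<epsilon>) (f u \<one>\<^bsub>K\<^esub>) \<noteq> \<zero>\<^bsub>K\<^esub>"
    using gf1 by simp
  show "a $ i \<le> c $ i + ereal \<epsilon>" "b $ i \<le> d $ i + ereal \<epsilon>"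
    by (rule rectangle_morphism_corners[OF K g f_in uS g_nz])+
qed

section \<open>The interleaving criterion and the distance formula\<close>

lemma interleaved_rectangle_iff:
  fixes a b c d :: "ereal ^ 'n :: finite"
  assumes K: "Ring.field K" and \<epsilon>: "0 \<le> \<epsilon>"
  shows "interleaved K \<epsilon> (rectangle_module K (open_rectangle a b))
      (rectangle_module K (open_rectangle c d)) \<longleftrightarrow>
    (\<exists>i. b $ i \<le> a $ i + ereal (2 * \<epsilon>)) \<and> (\<exists>i. d $ i \<le> c $ i + ereal (2 * \<epsilon>)) \<or>
    (\<forall>i. a $ i \<le> c $ i + ereal \<epsilon> \<and> c $ i \<le> a $ i + ereal \<epsilon> \<and>
      b $ i \<le> d $ i + ereal \<epsilon> \<and> d $ i \<le> b $ i + ereal \<epsilon>)"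
    (is "?int \<longleftrightarrow> ?thin a b \<and> ?thin c d \<or> ?close")
proof
  assume ?int
  show "?thin a b \<and> ?thin c d \<or> ?close"
  proof (cases "?thin a b")
    case False
    then show ?thesis
      using interleaved_rectangle_imp_close[OF K \<epsilon> \<open>?int\<close>] by (auto simp: not_le)
  next
    case True
    \<comment> \<open>If the second rectangle is wide, the roles are exchanged;
      \<open>?close\<close> is symmetric under this exchange.\<close>
    then show ?thesis
      using interleaved_rectangle_imp_close[OF K \<epsilon> interleaved_sym[THEN iffD1, OF \<open>?int\<close>]]
      by (cases "?thin c d") (auto simp: not_le)
  qed
next
  have thin: "u + vec (2 * \<epsilon>) \<notin> open_rectangle p q"
    if "?thin p q" "u \<in> open_rectangle p q" for p q :: "ereal ^ 'n" and u
  proof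
    assume u2: "u + vec (2 * \<epsilon>) \<in> open_rectangle p q"
    from that(1) obtain i where "q $ i \<le> p $ i + ereal (2 * \<epsilon>)" by blast
    moreover have "p $ i < ereal (u $ i)" "ereal (u $ i + 2 * \<epsilon>) < q $ i"
      using that(2) u2 by (auto simp: open_rectangle_def)
    ultimately show False by (cases "p $ i"; cases "q $ i") auto
  qed
  assume "?thin a b \<and> ?thin c d \<or> ?close"
  then show ?int
    using interleaved_rectangle_zero[OF K thin thin]
      interleaved_rectangle_close[OF K, of a c \<epsilon> b d]
    by blast
qed

theorem corollary3p10:
  fixes K :: "('k, 'e) ring_scheme"
    and a b c d :: "ereal ^ 'n :: finite"
  assumes "Ring.field K"
    and "\<forall>i. a $ i \<noteq> \<infinity>" and "\<forall>i. c $ i \<noteq> \<infinity>"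
    and "\<forall>i. b $ i \<noteq> -\<infinity>" and "\<forall>i. d $ i \<noteq> -\<infinity>"
    and "\<forall>i. a $ i < b $ i" and "\<forall>i. c $ i < d $ i"
  shows "interleaving_distance K
      (rectangle_module K (open_rectangle a b)) (rectangle_module K (open_rectangle c d)) =
    min (max (MIN i. (b $ i -\<^sub>e a $ i) / 2) (MIN i. (d $ i -\<^sub>e c $ i) / 2))
        (max (linf_norm (\<chi> i. c $ i -\<^sub>e a $ i)) (linf_norm (\<chi> i. d $ i -\<^sub>e b $ i)))"
    (is "_ = ?L")
proof -
  \<comment> \<open>Bounding \<open>?L\<close> by \<open>\<epsilon>\<close> turns its minima into
    disjunctions or existentials and its maxima into conjunctions or universals, which is the shape
    of the criterion. The admissible \<open>\<epsilon>\<close> thus form the ray of nonnegative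
    reals from \<open>?L\<close> on.\<close>
  have interleaved_iff: "interleaved K \<epsilon> (rectangle_module K (open_rectangle a b))
      (rectangle_module K (open_rectangle c d)) \<longleftrightarrow> ?L \<le> ereal \<epsilon>" if "0 \<le> \<epsilon>" for \<epsilon>
    unfolding interleaved_rectangle_iff[OF assms(1) that] min_le_iff_disj max.bounded_iff
      MIN_le_iff linf_norm_le_iff
    unfolding half_ext_minus_le_iff[OF assms(6)[rule_format]]
      half_ext_minus_le_iff[OF assms(7)[rule_format]] vec_lambda_beta
      abs_ext_minus_le_iff[OF that]
    by blast
  \<comment> \<open>Since the infimum ranges over nonnegative reals, the ray starts at
    \<open>?L\<close> itself only if \<open>?L\<close> is nonnegative.\<close>
  have L: "0 \<le> ?L"
  proof -
    have "0 \<le> (b $ i -\<^sub>e a $ i) / 2" for i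
      using assms(6)[rule_format, of i] by (cases "a $ i"; cases "b $ i") (auto simp: ext_minus_def)
    then have "0 \<le> (MIN i. (b $ i -\<^sub>e a $ i) / 2)"
      by (subst Min_ge_iff) auto
    moreover have "0 \<le> linf_norm (\<chi> i. c $ i -\<^sub>e a $ i)"
      unfolding linf_norm_def by (subst Max_ge_iff) auto
    ultimately show ?thesis by (auto simp: le_max_iff_disj)
  qed
  show ?thesis
    unfolding interleaving_distance_def
  proof (rule antisym)
    show "Inf {ereal \<epsilon> |\<epsilon>. 0 \<le> \<epsilon> \<and> interleaved K \<epsilon> (rectangle_module K (open_rectangle a b))
        (rectangle_module K (open_rectangle c d))} \<le> ?L"
    proof (cases ?L)
      \<comment> \<open>A finite infimum is attained, because the criterion consists of non-strict
        inequalities.\<close>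
      case (real r)
      then have r: "0 \<le> r" using L[unfolded real] by simp
      have "interleaved K r (rectangle_module K (open_rectangle a b))
          (rectangle_module K (open_rectangle c d))"
        unfolding interleaved_iff[OF r] real by (rule order_refl)
      with r show ?thesis unfolding real by (blast intro: Inf_lower)
    next
      case PInf
      then show ?thesis by (simp only: PInf ereal_less_eq)
    next
      case MInf
      then show ?thesis using L[unfolded MInf] by simp
    qed
  qed (auto intro!: Inf_greatest simp only: interleaved_iff)
qed

end
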